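(* Let $\alpha$ be a countable ordinal and let $\kappa$ be an infinite cardinal. Fix a strictly decreasing sequence $(r_\beta)_{\beta<\alpha}$ of positive real numbers. Then for all $T,S\in\mathcal{T}^\kappa_\alpha$ we have $T\cong S$ if and only if the complete ultrametric spaces $X_T$ and $X_S$ are isometric.
   Context: Let $\kappa$ be a cardinal and $\alpha$ an ordinal. The set ${}^{<\alpha}\kappa$ consists of all functions $u\colon\beta\to\kappa$ with $\beta<\alpha$. It is ordered by inclusion, i.e. $u\subseteq v$ means that $u$ is an initial segment of $v$. The length of $u$ is $\mathrm{lh}(u)=\mathrm{dom}(u)$. For $u,v\in{}^{<\alpha}\kappa$, $u\sqcap v$ denotes their longest common initial segment. An $\alpha$-tree of size $\kappa$ is a subset $T\subseteq{}^{<\alpha}\kappa$ that is closed downward under $\subseteq$ and satisfies $|T|=\kappa$. The set of all such trees is denoted $\mathcal{T}^\kappa_\alpha$. For $T,S\in\mathcal{T}^\kappa_\alpha$, an isomorphism is a bijection $\varphi\colon T\to S$ such that $u\subseteq v\iff\varphi(u)\subseteq\varphi(v)$ for all $u,v\in T$. We write $T\cong S$ if such an isomorphism exists. Given $T\in\mathcal{T}^\kappa_\alpha$ and the fixed sequence $(r_\beta)_{\beta<\alpha}$, define a metric $d_T$ on $T$ by $d_T(u,v)=r_{\mathrm{lh}(u\sqcap v)}$ if $u\neq v$, and $d_T(u,u)=0$. This is an ultrametric. The space $X_T$ is defined to be the metric completion of $(T,d_T)$. *)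

theory Defs
  imports "HOL-Analysis.Analysis"
begin

unbundle cardinal_syntax

text \<open>
  An ordinal is given by a well-order relation \<open>\<alpha>\<close>; the ordinals \<open>\<beta> < \<alpha>\<close> are represented by the
  elements \<open>\<beta>\<close> of \<open>Field \<alpha>\<close>, and the set of predecessors of \<open>\<beta>\<close> is \<open>underS \<alpha> \<beta>\<close>.
  A cardinal \<open>\<kappa>\<close> is given by a cardinal order (as in the BNF cardinal theories), whose underlying
  set is \<open>Field \<kappa>\<close>. A function \<open>u : \<beta> \<rightarrow> \<kappa>\<close> is a partial function with domain \<open>underS \<alpha> \<beta>\<close>, and
  inclusion of such functions is the library relation \<open>\<subseteq>\<^sub>m\<close>.
\<close>

definition seqs_below :: "'a rel \<Rightarrow> 'k rel \<Rightarrow> ('a \<rightharpoonup> 'k) set" where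
  "seqs_below \<alpha> \<kappa> = {u. (\<exists>\<beta> \<in> Field \<alpha>. dom u = underS \<alpha> \<beta>) \<and> ran u \<subseteq> Field \<kappa>}"

definition lh :: "'a rel \<Rightarrow> ('a \<rightharpoonup> 'k) \<Rightarrow> 'a" where
  "lh \<alpha> u = (THE \<beta>. \<beta> \<in> Field \<alpha> \<and> dom u = underS \<alpha> \<beta>)"

definition common_init :: "'a rel \<Rightarrow> 'k rel \<Rightarrow> ('a \<rightharpoonup> 'k) \<Rightarrow> ('a \<rightharpoonup> 'k) \<Rightarrow> ('a \<rightharpoonup> 'k)" where
  "common_init \<alpha> \<kappa> u v =
     (THE w. w \<in> seqs_below \<alpha> \<kappa> \<and> w \<subseteq>\<^sub>m u \<and> w \<subseteq>\<^sub>m v \<and>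
        (\<forall>w' \<in> seqs_below \<alpha> \<kappa>. w' \<subseteq>\<^sub>m u \<and> w' \<subseteq>\<^sub>m v \<longrightarrow> w' \<subseteq>\<^sub>m w))"

definition trees :: "'a rel \<Rightarrow> 'k rel \<Rightarrow> ('a \<rightharpoonup> 'k) set set" where
  "trees \<alpha> \<kappa> = {T. T \<subseteq> seqs_below \<alpha> \<kappa> \<and>
                    (\<forall>v \<in> T. \<forall>u \<in> seqs_below \<alpha> \<kappa>. u \<subseteq>\<^sub>m v \<longrightarrow> u \<in> T) \<and>
                    ( |T|, \<kappa>) \<in> ordIso}"

definition tree_isomorphic :: "('a \<rightharpoonup> 'k) set \<Rightarrow> ('a \<rightharpoonup> 'k) set \<Rightarrow> bool" where
  "tree_isomorphic T S \<longleftrightarrow>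
     (\<exists>\<phi>. bij_betw \<phi> T S \<and> (\<forall>u \<in> T. \<forall>v \<in> T. u \<subseteq>\<^sub>m v \<longleftrightarrow> \<phi> u \<subseteq>\<^sub>m \<phi> v))"

text \<open>
  The value \<open>0\<close> outside of \<open>T\<close> is needed since the library's metric spaces require nonnegativity and
  symmetry of the distance function on the whole type.
\<close>

definition tree_dist ::
    "'a rel \<Rightarrow> 'k rel \<Rightarrow> ('a \<Rightarrow> real) \<Rightarrow> ('a \<rightharpoonup> 'k) set \<Rightarrow> ('a \<rightharpoonup> 'k) \<Rightarrow> ('a \<rightharpoonup> 'k) \<Rightarrow> real" where
  "tree_dist \<alpha> \<kappa> r T u v =
     (if u \<in> T \<and> v \<in> T \<and> u \<noteq> v then r (lh \<alpha> (common_init \<alpha> \<kappa> u v)) else 0)"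

definition tree_metric ::
    "'a rel \<Rightarrow> 'k rel \<Rightarrow> ('a \<Rightarrow> real) \<Rightarrow> ('a \<rightharpoonup> 'k) set \<Rightarrow> ('a \<rightharpoonup> 'k) metric" where
  "tree_metric \<alpha> \<kappa> r T = metric (T, tree_dist \<alpha> \<kappa> r T)"

definition is_completion :: "'x metric \<Rightarrow> 'y metric \<Rightarrow> bool" where
  "is_completion m m' \<longleftrightarrow> mcomplete_of m' \<and>
     (\<exists>f. f \<in> mspace m \<rightarrow> mspace m' \<and>
          (\<forall>x \<in> mspace m. \<forall>y \<in> mspace m. mdist m' (f x) (f y) = mdist m x y) \<and>
          mtopology_of m' closure_of (f ` mspace m) = mspace m')"

text \<open>
  The metric completion is unique up to isometry; a fixed one is chosen among those living on
  \<open>'x \<Rightarrow> real\<close>, a type on which one always exists (lemma \<open>is_completion_mcompletion\<close>).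
\<close>

definition mcompletion :: "'x metric \<Rightarrow> ('x \<Rightarrow> real) metric" where
  "mcompletion m = (SOME m'. is_completion m m')"

definition isometric_spaces :: "'x metric \<Rightarrow> 'y metric \<Rightarrow> bool" where
  "isometric_spaces m m' \<longleftrightarrow>
     (\<exists>f. bij_betw f (mspace m) (mspace m') \<and>
          (\<forall>x \<in> mspace m. \<forall>y \<in> mspace m. mdist m' (f x) (f y) = mdist m x y))"

definition tree_space ::
    "'a rel \<Rightarrow> 'k rel \<Rightarrow> ('a \<Rightarrow> real) \<Rightarrow> ('a \<rightharpoonup> 'k) set \<Rightarrow> (('a \<rightharpoonup> 'k) \<Rightarrow> real) metric" where
  "tree_space \<alpha> \<kappa> r T = mcompletion (tree_metric \<alpha> \<kappa> r T)"


lemma is_completion_mcompletion: "is_completion m (mcompletion m)"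
proof -
  interpret Metric_space "mspace m" "mdist m" by simp
  have "\<exists>m' :: ('a \<Rightarrow> real) metric. is_completion m m'"
    unfolding is_completion_def by (rule metric_completion) blast
  then show ?thesis unfolding mcompletion_def by (rule someI_ex)
qed

lemma underS_inj:
  assumes "Well_order \<alpha>" "\<beta> \<in> Field \<alpha>" "\<gamma> \<in> Field \<alpha>" "underS \<alpha> \<beta> = underS \<alpha> \<gamma>"
  shows "\<beta> = \<gamma>"
proof (rule ccontr)
  assume "\<beta> \<noteq> \<gamma>"
  moreover have "Total \<alpha>" using assms(1) by (simp add: order_on_defs)
  ultimately have "(\<beta>, \<gamma>) \<in> \<alpha> \<or> (\<gamma>, \<beta>) \<in> \<alpha>"
    using assms(2,3) by (auto simp: total_on_def)
  then show False using assms(4) \<open>\<beta> \<noteq> \<gamma>\<close> unfolding underS_def by blast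
qed

lemma lh_eqI:
  assumes "Well_order \<alpha>" "\<beta> \<in> Field \<alpha>" "dom u = underS \<alpha> \<beta>"
  shows "lh \<alpha> u = \<beta>"
  unfolding lh_def using assms by (intro the_equality) (auto intro: underS_inj)

lemma lh_common_init:
  assumes wo: "Well_order \<alpha>" and u: "u \<in> seqs_below \<alpha> \<kappa>" and v: "v \<in> seqs_below \<alpha> \<kappa>"
    and "u \<noteq> v"
  shows "lh \<alpha> (common_init \<alpha> \<kappa> u v) \<in> Field \<alpha>"
    and "u (lh \<alpha> (common_init \<alpha> \<kappa> u v)) \<noteq> v (lh \<alpha> (common_init \<alpha> \<kappa> u v))"
    and "\<And>\<gamma>. \<gamma> \<in> underS \<alpha> (lh \<alpha> (common_init \<alpha> \<kappa> u v)) \<Longrightarrow> u \<gamma> = v \<gamma>"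
proof -
  have tot: "Total \<alpha>" and tr: "trans \<alpha>" and an: "antisym \<alpha>" and wf: "wf (\<alpha> - Id)"
    using wo by (auto simp: order_on_defs)
  obtain bu bv where bu: "bu \<in> Field \<alpha>" "dom u = underS \<alpha> bu"
    and bv: "bv \<in> Field \<alpha>" "dom v = underS \<alpha> bv"
    using u v unfolding seqs_below_def by auto
  have down: "\<gamma> \<in> underS \<alpha> b" if "(\<gamma>, \<delta>) \<in> \<alpha>" "\<delta> \<in> underS \<alpha> b" for \<gamma> \<delta> b
    using that transD[OF tr, of \<gamma> \<delta> b] antisymD[OF an, of \<delta> b] unfolding underS_def by auto
  obtain b where ne: "u b \<noteq> v b" and min: "\<And>\<gamma>. (\<gamma>, b) \<in> \<alpha> - Id \<Longrightarrow> u \<gamma> = v \<gamma>"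
  proof -
    from \<open>u \<noteq> v\<close> obtain c where "u c \<noteq> v c" by (meson ext)
    then have "c \<in> {c. u c \<noteq> v c}" by simp
    from wfE_min[OF wf this] obtain b where "b \<in> {c. u c \<noteq> v c}"
      and "\<And>\<gamma>. (\<gamma>, b) \<in> \<alpha> - Id \<Longrightarrow> \<gamma> \<notin> {c. u c \<noteq> v c}" by metis
    then show thesis by (intro that[of b]) simp_all
  qed
  from ne have "b \<in> dom u \<or> b \<in> dom v" by (auto simp: dom_def)
  then have b: "b \<in> Field \<alpha>"
    using bu bv unfolding underS_def Field_def by auto
  have agree: "u \<gamma> = v \<gamma>" if "\<gamma> \<in> underS \<alpha> b" for \<gamma>
    using min that unfolding underS_def by auto
  have sub: "\<gamma> \<in> dom u" if "\<gamma> \<in> underS \<alpha> b" for \<gamma>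
  proof -
    have "(\<gamma>, b) \<in> \<alpha>" using that by (simp add: underS_def)
    then have "\<gamma> \<in> dom u \<or> \<gamma> \<in> dom v"
      using \<open>b \<in> dom u \<or> b \<in> dom v\<close> bu(2) bv(2) down by blast
    then show ?thesis using agree[OF that] by (auto simp: dom_def)
  qed
  define w where "w = u |` underS \<alpha> b"
  have domw: "dom w = underS \<alpha> b" using sub by (auto simp: w_def)
  have "ran w \<subseteq> ran u" unfolding w_def by (auto simp: ran_def restrict_map_def split: if_splits)
  then have w: "w \<in> seqs_below \<alpha> \<kappa>"
    using u b domw unfolding seqs_below_def by auto
  have wu: "w \<subseteq>\<^sub>m u" and wv: "w \<subseteq>\<^sub>m v"
    using agree by (auto simp: map_le_def w_def restrict_map_def split: if_splits)
  have greatest: "w' \<subseteq>\<^sub>m w" if "w' \<in> seqs_below \<alpha> \<kappa>" "w' \<subseteq>\<^sub>m u" "w' \<subseteq>\<^sub>m v" for w'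
  proof -
    obtain d where d: "d \<in> Field \<alpha>" "dom w' = underS \<alpha> d"
      using \<open>w' \<in> _\<close> unfolding seqs_below_def by auto
    have "b \<notin> dom w'" using ne that(2,3) by (metis map_le_def)
    have *: "\<gamma> \<in> underS \<alpha> b" if "\<gamma> \<in> dom w'" for \<gamma>
    proof -
      have "\<gamma> \<noteq> b" using that \<open>b \<notin> dom w'\<close> by blast
      moreover have "\<gamma> \<in> Field \<alpha>" using that d unfolding underS_def Field_def by auto
      moreover have "(b, \<gamma>) \<notin> \<alpha>" using down that \<open>b \<notin> dom w'\<close> d(2) by metis
      ultimately show ?thesis using tot b unfolding total_on_def underS_def by blast
    qed
    show ?thesis using * that(2) by (auto simp: map_le_def w_def)
  qed
  have "common_init \<alpha> \<kappa> u v = w"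
    unfolding common_init_def
  proof (rule the_equality)
    show "w \<in> seqs_below \<alpha> \<kappa> \<and> w \<subseteq>\<^sub>m u \<and> w \<subseteq>\<^sub>m v \<and>
        (\<forall>w' \<in> seqs_below \<alpha> \<kappa>. w' \<subseteq>\<^sub>m u \<and> w' \<subseteq>\<^sub>m v \<longrightarrow> w' \<subseteq>\<^sub>m w)"
      using w wu wv greatest by blast
  next
    fix w'
    assume w': "w' \<in> seqs_below \<alpha> \<kappa> \<and> w' \<subseteq>\<^sub>m u \<and> w' \<subseteq>\<^sub>m v \<and>
        (\<forall>w'' \<in> seqs_below \<alpha> \<kappa>. w'' \<subseteq>\<^sub>m u \<and> w'' \<subseteq>\<^sub>m v \<longrightarrow> w'' \<subseteq>\<^sub>m w')"
    have "w' \<subseteq>\<^sub>m w" using w' greatest by simp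
    moreover have "w \<subseteq>\<^sub>m w'" using w' w wu wv by simp
    ultimately show "w' = w" by (rule map_le_antisym)
  qed
  then have "lh \<alpha> (common_init \<alpha> \<kappa> u v) = b"
    using lh_eqI[OF wo b domw] by simp
  then show "lh \<alpha> (common_init \<alpha> \<kappa> u v) \<in> Field \<alpha>"
    and "u (lh \<alpha> (common_init \<alpha> \<kappa> u v)) \<noteq> v (lh \<alpha> (common_init \<alpha> \<kappa> u v))"
    and "\<And>\<gamma>. \<gamma> \<in> underS \<alpha> (lh \<alpha> (common_init \<alpha> \<kappa> u v)) \<Longrightarrow> u \<gamma> = v \<gamma>"
    using b ne agree by auto
qed

lemma tree_dist_ultrametric:
  assumes wo: "Well_order \<alpha>"
    and pos: "\<And>\<beta>. \<beta> \<in> Field \<alpha> \<Longrightarrow> 0 < r \<beta>"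
    and dec: "\<And>\<beta> \<gamma>. (\<beta>, \<gamma>) \<in> \<alpha> \<Longrightarrow> \<beta> \<noteq> \<gamma> \<Longrightarrow> r \<gamma> < r \<beta>"
    and T: "T \<in> trees \<alpha> \<kappa>" and xyz: "x \<in> T" "y \<in> T" "z \<in> T"
  shows "tree_dist \<alpha> \<kappa> r T x z \<le> max (tree_dist \<alpha> \<kappa> r T x y) (tree_dist \<alpha> \<kappa> r T y z)"
proof (cases "x = y \<or> y = z \<or> x = z")
  case True
  have "0 \<le> tree_dist \<alpha> \<kappa> r T x y"
    using lh_common_init(1)[OF wo, of x \<kappa> y] pos T xyz
    by (force simp: tree_dist_def trees_def intro: less_imp_le)
  then show ?thesis using True by (auto simp: tree_dist_def)
next
  case False
  have mem: "x \<in> seqs_below \<alpha> \<kappa>" "y \<in> seqs_below \<alpha> \<kappa>" "z \<in> seqs_below \<alpha> \<kappa>"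
    using T xyz by (auto simp: trees_def)
  let ?l = "\<lambda>u v. lh \<alpha> (common_init \<alpha> \<kappa> u v)"
  have tot: "Total \<alpha>" using wo by (simp add: order_on_defs)
  note xz = lh_common_init[OF wo mem(1) mem(3)] and xy = lh_common_init[OF wo mem(1) mem(2)]
    and yz = lh_common_init[OF wo mem(2) mem(3)]
  have "\<not> (?l x z \<in> underS \<alpha> (?l x y) \<and> ?l x z \<in> underS \<alpha> (?l y z))"
    using xz(2) xy(3)[of "?l x z"] yz(3)[of "?l x z"] False by auto
  moreover have "\<delta> \<in> underS \<alpha> \<gamma> \<or> \<gamma> = \<delta> \<or> (\<gamma>, \<delta>) \<in> \<alpha>" if "\<gamma> \<in> Field \<alpha>" "\<delta> \<in> Field \<alpha>" for \<gamma> \<delta>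
    using tot that unfolding total_on_def underS_def by blast
  ultimately have
    "(?l x y, ?l x z) \<in> \<alpha> \<or> ?l x y = ?l x z \<or> (?l y z, ?l x z) \<in> \<alpha> \<or> ?l y z = ?l x z"
    using xz(1) xy(1) yz(1) False by metis
  then have "r (?l x z) \<le> max (r (?l x y)) (r (?l y z))"
    using dec[of "?l x y" "?l x z"] dec[of "?l y z" "?l x z"]
    by (cases "?l x y = ?l x z"; cases "?l y z = ?l x z") (auto simp: le_max_iff_disj)
  then show ?thesis using False xyz by (simp add: tree_dist_def)
qed

lemma Metric_space_tree_dist:
  assumes wo: "Well_order \<alpha>"
    and pos: "\<And>\<beta>. \<beta> \<in> Field \<alpha> \<Longrightarrow> 0 < r \<beta>"
    and dec: "\<And>\<beta> \<gamma>. (\<beta>, \<gamma>) \<in> \<alpha> \<Longrightarrow> \<beta> \<noteq> \<gamma> \<Longrightarrow> r \<gamma> < r \<beta>"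
    and T: "T \<in> trees \<alpha> \<kappa>"
  shows "Metric_space T (tree_dist \<alpha> \<kappa> r T)"
proof -
  have sub: "T \<subseteq> seqs_below \<alpha> \<kappa>" using T by (simp add: trees_def)
  have d: "0 < tree_dist \<alpha> \<kappa> r T x y" if "x \<in> T" "y \<in> T" "x \<noteq> y" for x y
    using lh_common_init(1)[OF wo, of x \<kappa> y] pos sub that by (auto simp: tree_dist_def)
  have nn: "0 \<le> tree_dist \<alpha> \<kappa> r T x y" for x y
    using d[of x y] by (cases "x \<in> T \<and> y \<in> T \<and> x \<noteq> y") (auto simp: tree_dist_def)
  show ?thesis
  proof
    show "0 \<le> tree_dist \<alpha> \<kappa> r T x y" for x y by (rule nn)
    show "tree_dist \<alpha> \<kappa> r T x y = tree_dist \<alpha> \<kappa> r T y x" for x y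
    proof -
      have "common_init \<alpha> \<kappa> x y = common_init \<alpha> \<kappa> y x"
        unfolding common_init_def by (rule arg_cong[where f = The]) (auto simp: fun_eq_iff)
      then show ?thesis by (auto simp: tree_dist_def)
    qed
    show "tree_dist \<alpha> \<kappa> r T x y = 0 \<longleftrightarrow> x = y" if "x \<in> T" "y \<in> T" for x y
      using d[OF that] by (cases "x = y") (auto simp: tree_dist_def)
    show "tree_dist \<alpha> \<kappa> r T x z \<le> tree_dist \<alpha> \<kappa> r T x y + tree_dist \<alpha> \<kappa> r T y z"
      if "x \<in> T" "y \<in> T" "z \<in> T" for x y z
      using tree_dist_ultrametric[of \<alpha> r, OF wo pos dec T that] nn[of x y] nn[of y z] by linarith
  qed
qed

end

theory Submission
  imports Defs
begin

text \<open>
  In \<open>(T, d\<^sub>T)\<close> the distance from \<open>u\<close> to any other point is at least \<open>r (lh u)\<close>, so \<open>T\<close> is discrete and is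
  exactly the set of isolated points of its completion. Hence the completions are isometric iff
  \<open>(T, d\<^sub>T)\<close> and \<open>(S, d\<^sub>S)\<close> are.

  A tree isomorphism preserves lengths and meets, hence distances. Conversely, the proper extensions
  of a nonleaf \<open>u\<close> are its nearest points, so an isometry mapping nonleaves to nonleaves is a tree
  isomorphism. An arbitrary isometry can only confuse a nonleaf with a leaf that is one of its children. Call
  two points twins if each is a nearest point of the other; then every twin class contains exactly
  one nonleaf, and permuting points inside the twin classes is an isometry. So every isometry can be
  corrected by such a permutation to one that respects nonleaves.
\<close>

subsection \<open>Isometries of completions\<close>

lemma dense_approx:
  assumes "mtopology_of m closure_of S = mspace m" "x \<in> mspace m" "0 < e"
  obtains s where "s \<in> S" "s \<in> mspace m" "mdist m x s < e"
proof -
  interpret Metric_space "mspace m" "mdist m" by simp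
  have "x \<in> mtopology closure_of S" using assms by (simp add: mtopology_of_def)
  then show thesis using that assms(3) by (auto simp: metric_closure_of)
qed

text \<open>A Lipschitz map on \<open>S\<close> into a complete space extends to the closure of
  \<open>S\<close>. The extension \<open>g\<close> comes with some Lipschitz constant
  \<open>B\<close> only, so exact preservation of distances is carried over from \<open>S\<close> by
  approximation.\<close>

lemma isometry_extends_from_dense:
  assumes compl: "mcomplete_of m'"
    and S: "S \<subseteq> mspace m" and dense: "mtopology_of m closure_of S = mspace m"
    and k: "k \<in> S \<rightarrow> mspace m'"
    and iso: "\<And>x y. x \<in> S \<Longrightarrow> y \<in> S \<Longrightarrow> mdist m' (k x) (k y) = mdist m x y"
  obtains g where "g \<in> mspace m \<rightarrow> mspace m'"
    and "\<And>x y. x \<in> mspace m \<Longrightarrow> y \<in> mspace m \<Longrightarrow> mdist m' (g x) (g y) = mdist m x y"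
    and "\<And>x. x \<in> S \<Longrightarrow> g x = k x"
proof -
  interpret M: Metric_space "mspace m" "mdist m" by simp
  interpret M': Metric_space "mspace m'" "mdist m'" by simp
  have "Lipschitz_continuous_map (submetric m S) m' k"
    unfolding Lipschitz_continuous_map_def using k iso by (auto intro!: exI[of _ 1])
  then obtain g where lip: "Lipschitz_continuous_map (submetric m (mspace m)) m' g"
    and gk: "\<And>x. x \<in> S \<Longrightarrow> g x = k x"
    using Lipschitz_continuous_map_extends_to_closure_of[OF compl, of m S k] dense by auto
  then have gm: "g \<in> mspace m \<rightarrow> mspace m'"
    by (simp add: Lipschitz_continuous_map_def)
  from lip obtain B where "B > 0"
    and B: "\<And>x y. x \<in> mspace m \<Longrightarrow> y \<in> mspace m \<Longrightarrow> mdist m' (g x) (g y) \<le> B * mdist m x y"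
    by (auto simp: Lipschitz_continuous_map_pos)
  have "mdist m' (g x) (g y) = mdist m x y" if x: "x \<in> mspace m" and y: "y \<in> mspace m" for x y
  proof -
    have "\<bar>mdist m' (g x) (g y) - mdist m x y\<bar> \<le> e" if "0 < e" for e
    proof -
      \<comment> \<open>Moving \<open>x\<close> and \<open>y\<close> to points of \<open>S\<close>
        at distance below \<open>e'\<close> costs at most \<open>2 * e'\<close> in \<open>m\<close>
        and \<open>2 * B * e'\<close> in \<open>m'\<close>, together \<open>e\<close>.\<close>
      define e' where "e' = e / (2 * (B + 1))"
      have e': "0 < e'" and ee: "2 * (B + 1) * e' = e"
        using \<open>0 < e\<close> \<open>0 < B\<close> by (auto simp: e'_def)
      obtain s where s: "s \<in> S" "s \<in> mspace m" "mdist m x s < e'"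
        using dense_approx[OF dense x e'] .
      obtain t where t: "t \<in> S" "t \<in> mspace m" "mdist m y t < e'"
        using dense_approx[OF dense y e'] .
      have "\<bar>mdist m x y - mdist m s t\<bar> \<le> mdist m x s + mdist m y t"
        using x y s t by (smt (verit) M.commute M.triangle)
      moreover have "\<bar>mdist m' (g x) (g y) - mdist m' (g s) (g t)\<bar>
          \<le> mdist m' (g x) (g s) + mdist m' (g y) (g t)"
        using gm x y s t by (smt (verit) M'.commute M'.triangle PiE)
      moreover have "mdist m' (g x) (g s) \<le> B * e'" "mdist m' (g y) (g t) \<le> B * e'"
        using B[of x s] B[of y t] x y s t \<open>0 < B\<close>
        by (auto intro: order_trans[OF _ mult_left_mono[of _ e' B]])
      moreover have "mdist m' (g s) (g t) = mdist m s t"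
        using s t gk iso by simp
      ultimately show ?thesis using s(3) t(3) ee by (simp add: algebra_simps)
    qed
    then have "\<bar>mdist m' (g x) (g y) - mdist m x y\<bar> \<le> 0"
      by (rule field_le_epsilon) simp
    then show ?thesis by simp
  qed
  with gm gk that show thesis by blast
qed

text \<open>\<open>h \<circ> g\<close> and the identity are continuous and agree on a dense set.
  Concretely, a point of \<open>S\<close> within \<open>e / 2\<close> of \<open>x\<close> is fixed
  by \<open>h \<circ> g\<close>, hence also within \<open>e / 2\<close> of
  \<open>h (g x)\<close>.\<close>

lemma isometries_inverse_from_dense:
  assumes dense: "mtopology_of m closure_of S = mspace m"
    and g: "g \<in> mspace m \<rightarrow> mspace m'" and h: "h \<in> mspace m' \<rightarrow> mspace m"
    and gd: "\<And>x y. x \<in> mspace m \<Longrightarrow> y \<in> mspace m \<Longrightarrow> mdist m' (g x) (g y) = mdist m x y"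
    and hd: "\<And>x y. x \<in> mspace m' \<Longrightarrow> y \<in> mspace m' \<Longrightarrow> mdist m (h x) (h y) = mdist m' x y"
    and hg: "\<And>x. x \<in> S \<Longrightarrow> h (g x) = x"
    and x: "x \<in> mspace m"
  shows "h (g x) = x"
proof -
  interpret M: Metric_space "mspace m" "mdist m" by simp
  have hgx: "h (g x) \<in> mspace m" using g h x by auto
  have "mdist m (h (g x)) x \<le> 0 + e" if "0 < e" for e
  proof -
    have "0 < e / 2" using that by simp
    then obtain s where s: "s \<in> S" "s \<in> mspace m" "mdist m x s < e / 2"
      using dense_approx[OF dense x] by blast
    have gx: "g x \<in> mspace m'" "g s \<in> mspace m'" using g x s by auto
    have "mdist m (h (g x)) x \<le> mdist m (h (g x)) s + mdist m s x"
      using M.triangle hgx x s by simp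
    moreover have "mdist m (h (g x)) s = mdist m x s"
      using hd[OF gx] gd[of x s] hg[of s] x s by simp
    ultimately show ?thesis using s by (simp add: M.commute)
  qed
  then have "mdist m (h (g x)) x \<le> 0" by (rule field_le_epsilon)
  then show ?thesis using hgx x by (metis M.nonneg M.zero order_antisym)
qed

lemma isometry_inj_on:
  assumes f: "f \<in> mspace m \<rightarrow> mspace m'"
    and fd: "\<And>x y. x \<in> mspace m \<Longrightarrow> y \<in> mspace m \<Longrightarrow> mdist m' (f x) (f y) = mdist m x y"
  shows "inj_on f (mspace m)"
proof (rule inj_onI)
  interpret M: Metric_space "mspace m" "mdist m" by simp
  interpret M': Metric_space "mspace m'" "mdist m'" by simp
  fix x y assume xy: "x \<in> mspace m" "y \<in> mspace m" "f x = f y"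
  then have "f y \<in> mspace m'" using f by auto
  then have "mdist m x y = 0" using fd[OF xy(1,2)] xy(3) by simp
  then show "x = y" using xy by simp
qed

text \<open>An isometry between the dense images of \<open>m\<close> and \<open>m'\<close> and its
  inverse both extend to the completions, and the extensions are mutually inverse because they are
  so on dense sets.\<close>

lemma completions_isometric:
  assumes "is_completion m c" and "is_completion m' c'" and "isometric_spaces m m'"
  shows "isometric_spaces c c'"
proof -
  obtain i where i: "i \<in> mspace m \<rightarrow> mspace c" "mtopology_of c closure_of (i ` mspace m) = mspace c"
    and id: "\<And>x y. x \<in> mspace m \<Longrightarrow> y \<in> mspace m \<Longrightarrow> mdist c (i x) (i y) = mdist m x y"
    and c: "mcomplete_of c"
    using assms(1) by (auto simp: is_completion_def)
  obtain j where j: "j \<in> mspace m' \<rightarrow> mspace c'" "mtopology_of c' closure_of (j ` mspace m') = mspace c'"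
    and jd: "\<And>x y. x \<in> mspace m' \<Longrightarrow> y \<in> mspace m' \<Longrightarrow> mdist c' (j x) (j y) = mdist m' x y"
    and c': "mcomplete_of c'"
    using assms(2) by (auto simp: is_completion_def)
  obtain f where bij: "bij_betw f (mspace m) (mspace m')"
    and fd: "\<And>x y. x \<in> mspace m \<Longrightarrow> y \<in> mspace m \<Longrightarrow> mdist m' (f x) (f y) = mdist m x y"
    using assms(3) by (auto simp: isometric_spaces_def)
  have fm: "f x \<in> mspace m'" if "x \<in> mspace m" for x using bij that by (rule bij_betw_apply)
  have i_inj: "inj_on i (mspace m)" using i(1) id by (rule isometry_inj_on)
  have j_inj: "inj_on j (mspace m')" using j(1) jd by (rule isometry_inj_on)
  \<comment> \<open>\<open>k\<close> and \<open>l\<close> are \<open>f\<close> and its inverse,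
    transported along the embeddings \<open>i\<close> and \<open>j\<close> to the dense
    images.\<close>
  define k where "k = j \<circ> f \<circ> inv_into (mspace m) i"
  define l where "l = i \<circ> inv_into (mspace m) f \<circ> inv_into (mspace m') j"
  have ki: "k (i x) = j (f x)" if "x \<in> mspace m" for x
    using that i_inj by (simp add: k_def)
  have lj: "l (j (f x)) = i x" if "x \<in> mspace m" for x
    using that j_inj fm[OF that] bij by (simp add: l_def bij_betw_inv_into_left)
  have img: "j ` mspace m' = (\<lambda>x. j (f x)) ` mspace m"
    using bij by (metis bij_betw_imp_surj_on image_image)
  obtain g where g: "g \<in> mspace c \<rightarrow> mspace c'"
    and gd: "\<And>x y. x \<in> mspace c \<Longrightarrow> y \<in> mspace c \<Longrightarrow> mdist c' (g x) (g y) = mdist c x y"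
    and gk: "\<And>x. x \<in> i ` mspace m \<Longrightarrow> g x = k x"
  proof (rule isometry_extends_from_dense[OF c' _ i(2), of k])
    show "i ` mspace m \<subseteq> mspace c" "k \<in> i ` mspace m \<rightarrow> mspace c'"
      using i(1) j(1) ki fm by auto
    show "mdist c' (k x) (k y) = mdist c x y" if "x \<in> i ` mspace m" "y \<in> i ` mspace m" for x y
      using that ki id jd fd fm by auto
  qed blast
  obtain h where h: "h \<in> mspace c' \<rightarrow> mspace c"
    and hd: "\<And>x y. x \<in> mspace c' \<Longrightarrow> y \<in> mspace c' \<Longrightarrow> mdist c (h x) (h y) = mdist c' x y"
    and hl: "\<And>x. x \<in> j ` mspace m' \<Longrightarrow> h x = l x"
  proof (rule isometry_extends_from_dense[OF c _ j(2), of l])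
    show "j ` mspace m' \<subseteq> mspace c'" "l \<in> j ` mspace m' \<rightarrow> mspace c"
      using i(1) j(1) lj fm unfolding img by auto
    show "mdist c (l x) (l y) = mdist c' x y" if "x \<in> j ` mspace m'" "y \<in> j ` mspace m'" for x y
      using that lj id jd fd fm unfolding img by auto
  qed blast
  have "h (g x) = x" if "x \<in> mspace c" for x
    by (rule isometries_inverse_from_dense[OF i(2) g h gd hd _ that])
      (auto simp: gk ki hl lj fm)
  moreover have "g (h y) = y" if "y \<in> mspace c'" for y
    by (rule isometries_inverse_from_dense[OF j(2) h g hd gd _ that])
      (auto simp: img gk ki hl lj fm)
  ultimately have "bij_betw g (mspace c) (mspace c')"
    using g h by (auto intro!: bij_betw_byWitness[where f' = h])
  then show ?thesis unfolding isometric_spaces_def using gd by blast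
qed

section \<open>Recovering a discrete space from its completion\<close>

text \<open>An isolated point lies in every dense set. Conversely, an isolation radius of
  \<open>x\<close> in \<open>m\<close> still serves \<open>i x\<close> in \<open>c\<close>: another
  point of \<open>c\<close> that close could be approximated by points of the image, which would
  then be too close to \<open>i x\<close>.\<close>

lemma isolated_points_of_completion:
  assumes i: "i \<in> mspace m \<rightarrow> mspace c" and dense: "mtopology_of c closure_of (i ` mspace m) = mspace c"
    and id: "\<And>x y. x \<in> mspace m \<Longrightarrow> y \<in> mspace m \<Longrightarrow> mdist c (i x) (i y) = mdist m x y"
    and discr: "\<And>x. x \<in> mspace m \<Longrightarrow> \<exists>e>0. \<forall>y\<in>mspace m. mdist m x y < e \<longrightarrow> y = x"
  shows "i ` mspace m = {x \<in> mspace c. \<exists>e>0. \<forall>y\<in>mspace c. mdist c x y < e \<longrightarrow> y = x}"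
proof (intro equalityI subsetI)
  interpret Metric_space "mspace c" "mdist c" by simp
  fix z assume "z \<in> i ` mspace m"
  then obtain x where x: "x \<in> mspace m" "z = i x" by blast
  obtain e where e: "e > 0" "\<forall>y\<in>mspace m. mdist m x y < e \<longrightarrow> y = x" using discr x by blast
  have z: "z \<in> mspace c" using i x by auto
  moreover have "y = z" if y: "y \<in> mspace c" and yz: "mdist c z y < e" for y
  proof (rule ccontr)
    assume "y \<noteq> z"
    \<comment> \<open>The second bound keeps \<open>x'\<close> within \<open>e\<close> of
      \<open>x\<close> and so forces \<open>x' = x\<close>; the first puts \<open>i x'\<close>
      nearer to \<open>y\<close> than \<open>z = i x\<close> is, a contradiction.\<close>
    then have "0 < min (mdist c z y) (e - mdist c z y)"
      using yz y z by (simp add: mdist_pos_eq)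
    from dense_approx[OF dense y this] obtain x' where x': "x' \<in> mspace m" "i x' \<in> mspace c"
      "mdist c y (i x') < mdist c z y" "mdist c y (i x') < e - mdist c z y" by auto
    have "mdist m x x' \<le> mdist c z y + mdist c y (i x')"
      using triangle[OF z y x'(2)] x x' id by simp
    then have "x' = x" using x' e by force
    then show False using x' x by (simp add: commute)
  qed
  ultimately show "z \<in> {x \<in> mspace c. \<exists>e>0. \<forall>y\<in>mspace c. mdist c x y < e \<longrightarrow> y = x}"
    using e by blast
next
  fix z assume "z \<in> {x \<in> mspace c. \<exists>e>0. \<forall>y\<in>mspace c. mdist c x y < e \<longrightarrow> y = x}"
  then show "z \<in> i ` mspace m" using dense_approx[OF dense] by blast
qed

text \<open>Isolation is a metric property, so an isometry of the completions maps isolated points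
  onto isolated points, and these are exactly the embedded copies of \<open>m\<close> and
  \<open>m'\<close>.\<close>

lemma isometric_if_completions_isometric:
  assumes "is_completion m c" and "is_completion m' c'" and "isometric_spaces c c'"
    and discr: "\<And>x. x \<in> mspace m \<Longrightarrow> \<exists>e>0. \<forall>y\<in>mspace m. mdist m x y < e \<longrightarrow> y = x"
    and discr': "\<And>x. x \<in> mspace m' \<Longrightarrow> \<exists>e>0. \<forall>y\<in>mspace m'. mdist m' x y < e \<longrightarrow> y = x"
  shows "isometric_spaces m m'"
proof -
  obtain i where i: "i \<in> mspace m \<rightarrow> mspace c" "mtopology_of c closure_of (i ` mspace m) = mspace c"
    and id: "\<And>x y. x \<in> mspace m \<Longrightarrow> y \<in> mspace m \<Longrightarrow> mdist c (i x) (i y) = mdist m x y"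
    using assms(1) by (auto simp: is_completion_def)
  obtain j where j: "j \<in> mspace m' \<rightarrow> mspace c'" "mtopology_of c' closure_of (j ` mspace m') = mspace c'"
    and jd: "\<And>x y. x \<in> mspace m' \<Longrightarrow> y \<in> mspace m' \<Longrightarrow> mdist c' (j x) (j y) = mdist m' x y"
    using assms(2) by (auto simp: is_completion_def)
  obtain f where bij: "bij_betw f (mspace c) (mspace c')"
    and fd: "\<And>x y. x \<in> mspace c \<Longrightarrow> y \<in> mspace c \<Longrightarrow> mdist c' (f x) (f y) = mdist c x y"
    using assms(3) by (auto simp: isometric_spaces_def)
  have i_inj: "inj_on i (mspace m)" using i(1) id by (rule isometry_inj_on)
  have j_inj: "inj_on j (mspace m')" using j(1) jd by (rule isometry_inj_on)
  have f_img: "f ` mspace c = mspace c'" and f_inj: "inj_on f (mspace c)"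
    using bij by (auto simp: bij_betw_def)
  have iso: "f x \<in> j ` mspace m' \<longleftrightarrow> x \<in> i ` mspace m" if "x \<in> mspace c" for x
  proof -
    have "(\<forall>y\<in>mspace c'. mdist c' (f x) y < e \<longrightarrow> y = f x)
        \<longleftrightarrow> (\<forall>y\<in>mspace c. mdist c x y < e \<longrightarrow> y = x)" for e
      using that fd inj_on_eq_iff[OF f_inj] by (simp flip: f_img)
    moreover have "f x \<in> mspace c'" using that f_img by blast
    ultimately show ?thesis
      using that by (simp add: isolated_points_of_completion[OF i id discr]
        isolated_points_of_completion[OF j jd discr'])
  qed
  have "f ` (i ` mspace m) = j ` mspace m'"
  proof
    show "f ` (i ` mspace m) \<subseteq> j ` mspace m'" using iso i(1) by blast
    show "j ` mspace m' \<subseteq> f ` (i ` mspace m)"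
    proof
      fix y assume y: "y \<in> j ` mspace m'"
      then have "y \<in> f ` mspace c" using j(1) f_img by blast
      then show "y \<in> f ` (i ` mspace m)" using iso y by blast
    qed
  qed
  moreover have "inj_on f (i ` mspace m)"
    using f_inj i(1) by (auto intro: inj_on_subset)
  ultimately have "bij_betw f (i ` mspace m) (j ` mspace m')"
    by (simp add: bij_betw_def)
  moreover have "bij_betw i (mspace m) (i ` mspace m)" "bij_betw j (mspace m') (j ` mspace m')"
    using i_inj j_inj by (auto simp: bij_betw_def)
  ultimately have h: "bij_betw (inv_into (mspace m') j \<circ> (f \<circ> i)) (mspace m) (mspace m')"
    by (meson bij_betw_inv_into bij_betw_trans)
  have "j ((inv_into (mspace m') j \<circ> (f \<circ> i)) x) = f (i x)" if "x \<in> mspace m" for x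
    using that \<open>f ` (i ` mspace m) = j ` mspace m'\<close> by (auto intro!: f_inv_into_f)
  then have "mdist m' ((inv_into (mspace m') j \<circ> (f \<circ> i)) x) ((inv_into (mspace m') j \<circ> (f \<circ> i)) y)
      = mdist m x y" if "x \<in> mspace m" "y \<in> mspace m" for x y
    using that jd[OF bij_betw_apply[OF h that(1)] bij_betw_apply[OF h that(2)]] id[OF that]
      fd[of "i x" "i y"] funcset_mem[OF i(1)] by simp
  with h show ?thesis unfolding isometric_spaces_def by blast
qed

subsection \<open>Twins in ultrametric spaces\<close>

text \<open>The minimum need not be attained: a leaf of limit length in a tree has no nearest point,
  since its own initial segments come ever closer to it.\<close>

definition nearest :: "'x set \<Rightarrow> ('x \<Rightarrow> 'x \<Rightarrow> real) \<Rightarrow> 'x \<Rightarrow> 'x \<Rightarrow> bool" where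
  "nearest M d u v \<longleftrightarrow> v \<in> M \<and> v \<noteq> u \<and> (\<forall>w\<in>M. w \<noteq> u \<longrightarrow> d u v \<le> d u w)"

text \<open>Being nearest is not symmetric: every proper extension of a nonleaf is nearest to it,
  but an extension two levels up is closer to its own predecessor.\<close>

definition twin :: "'x set \<Rightarrow> ('x \<Rightarrow> 'x \<Rightarrow> real) \<Rightarrow> 'x \<Rightarrow> 'x \<Rightarrow> bool" where
  "twin M d u v \<longleftrightarrow> u = v \<or> nearest M d u v \<and> nearest M d v u"

text \<open>A system of representatives for the twin classes of those points that have a nearest
  point. A point without one is its own class and stays unrepresented.\<close>

definition twin_transversal :: "'x set \<Rightarrow> ('x \<Rightarrow> 'x \<Rightarrow> real) \<Rightarrow> 'x set \<Rightarrow> bool" where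
  "twin_transversal M d P \<longleftrightarrow> P \<subseteq> M \<and> (\<forall>p\<in>P. \<exists>v. nearest M d p v) \<and>
     (\<forall>u\<in>M. (\<exists>v. nearest M d u v) \<longrightarrow> (\<exists>p\<in>P. twin M d u p)) \<and>
     (\<forall>p\<in>P. \<forall>q\<in>P. twin M d p q \<longrightarrow> p = q)"

locale ultrametric_space = Metric_space +
  assumes ultra: "\<And>x y z. x \<in> M \<Longrightarrow> y \<in> M \<Longrightarrow> z \<in> M \<Longrightarrow> d x z \<le> max (d x y) (d y z)"
begin

text \<open>The points \<open>u\<close> and \<open>w\<close> are both nearest to \<open>v\<close>,
  hence equally far from it. The strong triangle inequality bounds \<open>d u w\<close> by this
  common distance, which is already minimal at \<open>u\<close> and at \<open>w\<close>.\<close>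

lemma twin_trans:
  assumes uv: "twin M d u v" and vw: "twin M d v w" and M: "u \<in> M" "v \<in> M" "w \<in> M"
  shows "twin M d u w"
proof (cases "u = v \<or> v = w \<or> u = w")
  case True
  then show ?thesis using uv vw by (auto simp: twin_def)
next
  case False
  then have n: "nearest M d u v" "nearest M d v u" "nearest M d v w" "nearest M d w v"
    using uv vw by (auto simp: twin_def)
  have eq: "d u v = d v w"
    using n(2,3) commute[of u v] unfolding nearest_def by (metis order_antisym)
  have "d u w \<le> d u v" using ultra[of u v w] M eq by simp
  then have "nearest M d u w" using n(1) M False unfolding nearest_def by fastforce
  moreover have "d w u \<le> d w v" using \<open>d u w \<le> d u v\<close> eq commute by simp
  then have "nearest M d w u" using n(4) M False unfolding nearest_def by fastforce
  ultimately show ?thesis by (simp add: twin_def)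
qed

text \<open>No third point is closer to \<open>u\<close> or \<open>v\<close> than they are to each
  other, so in the strong triangle inequality the term \<open>d u v\<close> never exceeds the other
  one, and each of the two distances bounds the other.\<close>

lemma dist_twin:
  assumes uv: "twin M d u v" and M: "u \<in> M" "v \<in> M" "x \<in> M" and x: "x \<noteq> u" "x \<noteq> v"
  shows "d u x = d v x"
proof (cases "u = v")
  case False
  then have "d u v \<le> d u x" "d v u \<le> d v x"
    using uv M x unfolding twin_def nearest_def by auto
  then show ?thesis
    using ultra[of u v x] ultra[of v u x] M by (auto simp: commute[of v u] max_def split: if_splits)
qed simp

text \<open>The points are moved one at a time, from \<open>u\<close> to \<open>s u\<close> and then
  from \<open>v\<close> to \<open>s v\<close>; each move keeps the distance by
  \<open>dist_twin\<close>, whose third point must differ from both twins. The pair of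
  \<open>u\<close> and \<open>s u\<close> is merely exchanged.\<close>

lemma twin_involution_isometry:
  assumes s: "\<forall>u\<in>M. s u \<in> M \<and> s (s u) = u \<and> twin M d u (s u)"
    and uv: "u \<in> M" "v \<in> M"
  shows "d (s u) (s v) = d u v"
proof -
  consider "u = v" | "v = s u" | "u \<noteq> v" "v \<noteq> s u" by blast
  then show ?thesis
  proof cases
    case 1
    then show ?thesis using s uv by simp
  next
    case 2
    then show ?thesis using s uv by (simp add: commute)
  next
    case 3
    have ne: "s u \<noteq> s v" using s uv 3 by metis
    have "d u v = d (s u) v" using dist_twin[of u "s u" v] s uv 3 by auto
    also have "\<dots> = d v (s u)" by (rule commute)
    also have "\<dots> = d (s v) (s u)" using dist_twin[of v "s v" "s u"] s uv 3 ne by auto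
    finally show ?thesis by (simp add: commute)
  qed
qed

text \<open>In each twin class the representative from \<open>P\<close> is exchanged with the one
  from \<open>Q\<close>; all other points stay fixed.\<close>

lemma transversal_swap:
  assumes P: "twin_transversal M d P" and Q: "twin_transversal M d Q"
  obtains s where "\<forall>u\<in>M. s u \<in> M \<and> s (s u) = u \<and> twin M d u (s u)"
    and "\<And>u. u \<in> M \<Longrightarrow> s u \<in> Q \<longleftrightarrow> u \<in> P"
proof -
  have twin_in: "\<exists>b\<in>B. twin M d a b"
    if "twin_transversal M d A" "twin_transversal M d B" "a \<in> A" for A B a
    using that unfolding twin_transversal_def by (meson subsetD)
  obtain q where q: "\<And>u. u \<in> P \<Longrightarrow> q u \<in> Q \<and> twin M d u (q u)"
    using twin_in[OF P Q] by metis
  obtain p where p: "\<And>u. u \<in> Q \<Longrightarrow> p u \<in> P \<and> twin M d u (p u)"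
    using twin_in[OF Q P] by metis
  have PM: "P \<subseteq> M" and QM: "Q \<subseteq> M" using P Q by (auto simp: twin_transversal_def)
  have Pu: "v = u" if "u \<in> P" "v \<in> P" "twin M d u v" for u v
    using P that by (auto simp: twin_transversal_def)
  have Qu: "v = u" if "u \<in> Q" "v \<in> Q" "twin M d u v" for u v
    using Q that by (auto simp: twin_transversal_def)
  \<comment> \<open>By transitivity \<open>p (q u)\<close> is a twin of \<open>u\<close> in
    \<open>P\<close>, and a class has only one representative there.\<close>
  have pq: "p (q u) = u" if "u \<in> P" for u
    using q[OF that] p[of "q u"] twin_trans[of u "q u" "p (q u)"] Pu[of u "p (q u)"] that PM QM by auto
  have qp: "q (p u) = u" if "u \<in> Q" for u
    using p[OF that] q[of "p u"] twin_trans[of u "p u" "q (p u)"] Qu[of u "q (p u)"] that PM QM by auto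
  \<comment> \<open>A common representative is fixed by both maps, so the two cases in the
    definition of \<open>s\<close> agree where they overlap.\<close>
  have PQ: "q u = u \<and> p u = u" if "u \<in> P" "u \<in> Q" for u
    using q[OF that(1)] p[OF that(2)] Pu[of u "p u"] Qu[of u "q u"] that by blast
  define s where "s u = (if u \<in> P then q u else if u \<in> Q then p u else u)" for u
  show thesis
  proof (rule that[of s])
    show "\<forall>u\<in>M. s u \<in> M \<and> s (s u) = u \<and> twin M d u (s u)"
    proof
      fix u assume "u \<in> M"
      have "s (s u) = u"
      proof (cases "u \<in> P")
        case True
        then show ?thesis using q[OF True] pq[OF True] Pu[of u "q u"] by (auto simp: s_def)
      next
        case False
        then show ?thesis using p[of u] qp[of u] by (cases "u \<in> Q") (simp_all add: s_def)
      qed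
      moreover have "s u \<in> M" "twin M d u (s u)"
        using \<open>u \<in> M\<close> p[of u] q[of u] PM QM by (auto simp: s_def twin_def)
      ultimately show "s u \<in> M \<and> s (s u) = u \<and> twin M d u (s u)" by blast
    qed
    show "s u \<in> Q \<longleftrightarrow> u \<in> P" if "u \<in> M" for u
      using that p[of u] q[of u] PQ[of "p u"] qp[of u] by (auto simp: s_def)
  qed
qed

end

section \<open>Transport of twins along isometries\<close>

lemma nearest_isometry:
  assumes bij: "bij_betw f M M'"
    and fd: "\<forall>x\<in>M. \<forall>y\<in>M. d' (f x) (f y) = d x y"
    and uv: "u \<in> M" "v \<in> M"
  shows "nearest M' d' (f u) (f v) \<longleftrightarrow> nearest M d u v"
proof -
  have "inj_on f M" and M': "M' = f ` M" using bij by (auto simp: bij_betw_def)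
  then show ?thesis
    using uv fd by (auto simp: nearest_def M' inj_on_eq_iff)
qed

lemma twin_isometry:
  assumes bij: "bij_betw f M M'"
    and fd: "\<forall>x\<in>M. \<forall>y\<in>M. d' (f x) (f y) = d x y"
    and uv: "u \<in> M" "v \<in> M"
  shows "twin M' d' (f u) (f v) \<longleftrightarrow> twin M d u v"
  using bij uv nearest_isometry[of f M M' d' d, OF bij fd]
  by (auto simp: twin_def bij_betw_def inj_on_eq_iff)

text \<open>Transversals are defined by the metric alone, so they can be pulled back; this allows a
  comparison with a given transversal inside one space.\<close>

lemma twin_transversal_vimage:
  assumes bij: "bij_betw f M M'"
    and fd: "\<forall>x\<in>M. \<forall>y\<in>M. d' (f x) (f y) = d x y"
    and P': "twin_transversal M' d' P'"
  shows "twin_transversal M d {u \<in> M. f u \<in> P'}"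
proof -
  have M': "M' = f ` M" and inj: "inj_on f M" using bij by (auto simp: bij_betw_def)
  note n = nearest_isometry[of f M M' d' d, OF bij fd] and t = twin_isometry[of f M M' d' d, OF bij fd]
  have P'M: "P' \<subseteq> f ` M" using P' unfolding twin_transversal_def M' by (rule conjunct1)
  have ex: "(\<exists>v. nearest M' d' (f u) v) \<longleftrightarrow> (\<exists>v. nearest M d u v)" if "u \<in> M" for u
  proof -
    have "(\<exists>v. nearest M' d' (f u) v) \<longleftrightarrow> (\<exists>v\<in>M. nearest M' d' (f u) (f v))"
      unfolding nearest_def M' by blast
    also have "\<dots> \<longleftrightarrow> (\<exists>v\<in>M. nearest M d u v)" using n that by blast
    finally show ?thesis unfolding nearest_def by blast
  qed
  show ?thesis
    unfolding twin_transversal_def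
  proof (intro conjI ballI impI)
    fix p assume "p \<in> {u \<in> M. f u \<in> P'}"
    then show "\<exists>v. nearest M d p v" using P' ex[of p] by (auto simp: twin_transversal_def)
  next
    fix u assume u: "u \<in> M" "\<exists>v. nearest M d u v"
    then obtain p where p: "p \<in> P'" "twin M' d' (f u) p"
      using P' ex[of u] unfolding twin_transversal_def M' by blast
    then obtain p0 where p0: "p0 \<in> M" "p = f p0" using P'M by blast
    then have "twin M d u p0" using p(2) t[OF u(1) p0(1)] by simp
    then show "\<exists>p\<in>{u \<in> M. f u \<in> P'}. twin M d u p" using p(1) p0 by blast
  next
    fix p q assume "p \<in> {u \<in> M. f u \<in> P'}" "q \<in> {u \<in> M. f u \<in> P'}" "twin M d p q"
    then show "p = q" using P' t[of p q] inj by (auto simp: twin_transversal_def inj_on_def)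
  qed blast
qed

text \<open>The isometry \<open>f\<close> is precomposed with the twin swap that exchanges
  \<open>P\<close> with the preimage of \<open>P'\<close>.\<close>

lemma (in ultrametric_space) isometry_respecting_transversals:
  assumes bij: "bij_betw f M M'"
    and fd: "\<forall>x\<in>M. \<forall>y\<in>M. d' (f x) (f y) = d x y"
    and P: "twin_transversal M d P" and P': "twin_transversal M' d' P'"
  obtains g where "bij_betw g M M'"
    and "\<forall>x\<in>M. \<forall>y\<in>M. d' (g x) (g y) = d x y"
    and "\<And>x. x \<in> M \<Longrightarrow> g x \<in> P' \<longleftrightarrow> x \<in> P"
proof -
  obtain s where s: "\<forall>u\<in>M. s u \<in> M \<and> s (s u) = u \<and> twin M d u (s u)"
    and sP: "\<And>u. u \<in> M \<Longrightarrow> s u \<in> {u \<in> M. f u \<in> P'} \<longleftrightarrow> u \<in> P"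
    using transversal_swap[OF P twin_transversal_vimage[OF bij fd P']] by blast
  have "bij_betw s M M" using s by (auto intro!: bij_betw_byWitness[where f' = s])
  then have "bij_betw (f \<circ> s) M M'" using bij by (rule bij_betw_trans)
  moreover have "\<forall>x\<in>M. \<forall>y\<in>M. d' ((f \<circ> s) x) ((f \<circ> s) y) = d x y"
    using twin_involution_isometry[OF s] fd s by simp
  moreover have "(f \<circ> s) x \<in> P' \<longleftrightarrow> x \<in> P" if "x \<in> M" for x
    using sP[OF that] s that by simp
  ultimately show thesis by (rule that)
qed

subsection \<open>The metric of a tree\<close>

locale tree_metrics =
  fixes \<alpha> :: "'a rel" and \<kappa> :: "'k rel" and r :: "'a \<Rightarrow> real"
  assumes wo: "Well_order \<alpha>"
    and pos: "\<And>\<beta>. \<beta> \<in> Field \<alpha> \<Longrightarrow> 0 < r \<beta>"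
    and dec: "\<And>\<beta> \<gamma>. (\<beta>, \<gamma>) \<in> \<alpha> \<Longrightarrow> \<beta> \<noteq> \<gamma> \<Longrightarrow> r \<gamma> < r \<beta>"
begin

text \<open>For distinct sequences this is the first place where they differ as partial functions,
  being undefined counting as a value; it may therefore equal the length of one of them.\<close>

abbreviation split :: "('a \<rightharpoonup> 'k) \<Rightarrow> ('a \<rightharpoonup> 'k) \<Rightarrow> 'a" where
  "split u v \<equiv> lh \<alpha> (common_init \<alpha> \<kappa> u v)"

abbreviation nonleaves :: "('a \<rightharpoonup> 'k) set \<Rightarrow> ('a \<rightharpoonup> 'k) set" where
  "nonleaves T \<equiv> {u \<in> T. \<exists>v\<in>T. u \<subseteq>\<^sub>m v \<and> u \<noteq> v}"

lemma refl_\<alpha>: "\<beta> \<in> Field \<alpha> \<Longrightarrow> (\<beta>, \<beta>) \<in> \<alpha>"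
  using wo by (auto simp: order_on_defs refl_on_def)

lemma trans_\<alpha>: "(\<beta>, \<gamma>) \<in> \<alpha> \<Longrightarrow> (\<gamma>, \<delta>) \<in> \<alpha> \<Longrightarrow> (\<beta>, \<delta>) \<in> \<alpha>"
  using wo by (auto simp: order_on_defs dest: transD)

lemma antisym_\<alpha>: "(\<beta>, \<gamma>) \<in> \<alpha> \<Longrightarrow> (\<gamma>, \<beta>) \<in> \<alpha> \<Longrightarrow> \<beta> = \<gamma>"
  using wo by (auto simp: order_on_defs dest: antisymD)

lemma total_\<alpha>: "\<beta> \<in> Field \<alpha> \<Longrightarrow> \<gamma> \<in> Field \<alpha> \<Longrightarrow> \<beta> = \<gamma> \<or> (\<beta>, \<gamma>) \<in> \<alpha> \<or> (\<gamma>, \<beta>) \<in> \<alpha>"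
  using wo unfolding order_on_defs total_on_def by meson

lemma le_or_less: "\<beta> \<in> Field \<alpha> \<Longrightarrow> \<gamma> \<in> Field \<alpha> \<Longrightarrow> (\<beta>, \<gamma>) \<in> \<alpha> \<or> \<gamma> \<in> underS \<alpha> \<beta>"
  using total_\<alpha>[of \<beta> \<gamma>] refl_\<alpha>[of \<beta>] by (auto simp: underS_def)

lemma less_le_trans: "\<beta> \<in> underS \<alpha> \<gamma> \<Longrightarrow> (\<gamma>, \<delta>) \<in> \<alpha> \<Longrightarrow> \<beta> \<in> underS \<alpha> \<delta>"
  using trans_\<alpha>[of \<beta> \<gamma> \<delta>] antisym_\<alpha>[of \<beta> \<gamma>] by (auto simp: underS_def)

lemma le_iff_r:
  assumes "\<beta> \<in> Field \<alpha>" "\<gamma> \<in> Field \<alpha>"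
  shows "r \<gamma> \<le> r \<beta> \<longleftrightarrow> (\<beta>, \<gamma>) \<in> \<alpha>"
  using le_or_less[OF assms] dec[of \<beta> \<gamma>] dec[of \<gamma> \<beta>] antisym_\<alpha>[of \<beta> \<gamma>]
  by (cases "\<beta> = \<gamma>") (force simp: underS_def)+

lemma treesD:
  assumes "T \<in> trees \<alpha> \<kappa>" "u \<in> T"
  shows "u \<in> seqs_below \<alpha> \<kappa>" "lh \<alpha> u \<in> Field \<alpha>" "dom u = underS \<alpha> (lh \<alpha> u)" "ran u \<subseteq> Field \<kappa>"
proof -
  show u: "u \<in> seqs_below \<alpha> \<kappa>" using assms by (auto simp: trees_def)
  then obtain \<beta> where b: "\<beta> \<in> Field \<alpha>" "dom u = underS \<alpha> \<beta>" by (auto simp: seqs_below_def)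
  then show "lh \<alpha> u \<in> Field \<alpha>" "dom u = underS \<alpha> (lh \<alpha> u)"
    using lh_eqI[OF wo b] by auto
  show "ran u \<subseteq> Field \<kappa>" using u by (simp add: seqs_below_def)
qed

lemma restrict_in_tree:
  assumes T: "T \<in> trees \<alpha> \<kappa>" "u \<in> T" and g: "(\<gamma>, lh \<alpha> u) \<in> \<alpha>"
  shows "u |` underS \<alpha> \<gamma> \<in> T" "lh \<alpha> (u |` underS \<alpha> \<gamma>) = \<gamma>" "u |` underS \<alpha> \<gamma> \<subseteq>\<^sub>m u"
proof -
  have gF: "\<gamma> \<in> Field \<alpha>" using g by (auto simp: Field_def)
  have "underS \<alpha> \<gamma> \<subseteq> underS \<alpha> (lh \<alpha> u)"
    using less_le_trans[OF _ g] by blast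
  then have dom: "dom (u |` underS \<alpha> \<gamma>) = underS \<alpha> \<gamma>" using treesD(3)[OF T] by auto
  show "lh \<alpha> (u |` underS \<alpha> \<gamma>) = \<gamma>" using lh_eqI[OF wo gF dom] .
  show le: "u |` underS \<alpha> \<gamma> \<subseteq>\<^sub>m u" by (auto simp: map_le_def)
  have "ran (u |` underS \<alpha> \<gamma>) \<subseteq> ran u" by (auto simp: ran_def restrict_map_def split: if_splits)
  then have "u |` underS \<alpha> \<gamma> \<in> seqs_below \<alpha> \<kappa>"
    using treesD(4)[OF T] gF dom by (auto simp: seqs_below_def)
  then show "u |` underS \<alpha> \<gamma> \<in> T" using T le by (auto simp: trees_def)
qed

lemma map_le_lh:
  assumes T: "T \<in> trees \<alpha> \<kappa>" "u \<in> T" "v \<in> T" and le: "u \<subseteq>\<^sub>m v"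
  shows "(lh \<alpha> u, lh \<alpha> v) \<in> \<alpha>" "lh \<alpha> u = lh \<alpha> v \<Longrightarrow> u = v"
proof -
  have sub: "dom u \<subseteq> dom v" using le by (rule map_le_implies_dom_le)
  show "(lh \<alpha> u, lh \<alpha> v) \<in> \<alpha>"
    using le_or_less[of "lh \<alpha> u" "lh \<alpha> v"] treesD[OF T(1,2)] treesD[OF T(1,3)] sub
    by (auto simp: underS_def)
  assume "lh \<alpha> u = lh \<alpha> v"
  then have "dom u = dom v" using treesD(3)[OF T(1,2)] treesD(3)[OF T(1,3)] by simp
  then show "u = v" using le by (intro map_le_antisym) (auto simp: map_le_def)
qed

lemma split_facts:
  assumes T: "T \<in> trees \<alpha> \<kappa>" "u \<in> T" "v \<in> T" and ne: "u \<noteq> v"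
  shows "split u v \<in> Field \<alpha>" "(split u v, lh \<alpha> u) \<in> \<alpha>"
    and "split u v = lh \<alpha> u \<longleftrightarrow> u \<subseteq>\<^sub>m v"
    and "u |` underS \<alpha> (split u v) \<subseteq>\<^sub>m v"
    and "\<And>w. w \<in> T \<Longrightarrow> w \<subseteq>\<^sub>m u \<Longrightarrow> w \<subseteq>\<^sub>m v \<Longrightarrow> (lh \<alpha> w, split u v) \<in> \<alpha>"
proof -
  note c = lh_common_init[OF wo treesD(1)[OF T(1,2)] treesD(1)[OF T(1,3)] ne]
  note u = treesD[OF T(1,2)] and v = treesD[OF T(1,3)]
  show "split u v \<in> Field \<alpha>" by (rule c(1))
  show le: "(split u v, lh \<alpha> u) \<in> \<alpha>"
  proof (rule ccontr)
    assume "(split u v, lh \<alpha> u) \<notin> \<alpha>"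
    \<comment> \<open>Here \<open>u\<close> is undefined at \<open>split u v\<close>, so
      \<open>v\<close> is defined there and hence at the smaller \<open>lh \<alpha> u\<close>. But
      \<open>u\<close> and \<open>v\<close> agree below \<open>split u v\<close>, and
      \<open>u\<close> is undefined at its own length.\<close>
    then have less: "lh \<alpha> u \<in> underS \<alpha> (split u v)" using le_or_less[OF c(1) u(2)] by blast
    then have "u (split u v) = None"
      using u(3) \<open>(split u v, lh \<alpha> u) \<notin> \<alpha>\<close> by (auto simp: dom_def underS_def)
    then have "split u v \<in> dom v" using c(2) by (metis domIff)
    then have "(split u v, lh \<alpha> v) \<in> \<alpha>" "split u v \<noteq> lh \<alpha> v" using v(3) by (auto simp: underS_def)
    then have "lh \<alpha> u \<in> dom v"
      using less_le_trans[OF less, of "lh \<alpha> v"] v(3) by simp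
    then have "lh \<alpha> u \<in> dom u" using c(3)[OF less] by (auto simp: dom_def)
    then show False using u(3) by (auto simp: underS_def)
  qed
  show "u |` underS \<alpha> (split u v) \<subseteq>\<^sub>m v"
    using c(3) by (auto simp: map_le_def restrict_map_def)
  \<comment> \<open>A longer \<open>w\<close> would be defined at \<open>split u v\<close>, and its
    extensions \<open>u\<close> and \<open>v\<close> would agree there.\<close>
  show "(lh \<alpha> w, split u v) \<in> \<alpha>" if w: "w \<in> T" "w \<subseteq>\<^sub>m u" "w \<subseteq>\<^sub>m v" for w
  proof (rule ccontr)
    assume "(lh \<alpha> w, split u v) \<notin> \<alpha>"
    then have "split u v \<in> dom w"
      using le_or_less[OF treesD(2)[OF T(1) w(1)] c(1)] treesD(3)[OF T(1) w(1)] by blast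
    then show False using c(2) w by (metis map_le_def)
  qed
  from this[of u] have "split u v = lh \<alpha> u" if "u \<subseteq>\<^sub>m v" using that le T antisym_\<alpha> by simp
  moreover have "u \<subseteq>\<^sub>m v" if "split u v = lh \<alpha> u"
    using c(3) u(3) that by (auto simp: map_le_def)
  ultimately show "split u v = lh \<alpha> u \<longleftrightarrow> u \<subseteq>\<^sub>m v" by blast
qed

abbreviation d :: "('a \<rightharpoonup> 'k) set \<Rightarrow> ('a \<rightharpoonup> 'k) \<Rightarrow> ('a \<rightharpoonup> 'k) \<Rightarrow> real" where
  "d T \<equiv> tree_dist \<alpha> \<kappa> r T"

lemma d_eq: "u \<in> T \<Longrightarrow> v \<in> T \<Longrightarrow> u \<noteq> v \<Longrightarrow> d T u v = r (split u v)"
  by (simp add: tree_dist_def)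

text \<open>The branching level is at most \<open>lh \<alpha> u\<close>, with equality exactly when
  \<open>v\<close> extends \<open>u\<close>, and \<open>r\<close> reverses the order. The bound is
  what makes \<open>T\<close> discrete; the equality case is what recovers the order.\<close>

lemma d_ge:
  assumes T: "T \<in> trees \<alpha> \<kappa>" "u \<in> T" "v \<in> T" and ne: "u \<noteq> v"
  shows "r (lh \<alpha> u) \<le> d T u v" "d T u v \<le> r (lh \<alpha> u) \<longleftrightarrow> u \<subseteq>\<^sub>m v"
proof -
  note s = split_facts[OF T ne]
  show "r (lh \<alpha> u) \<le> d T u v"
    using s le_iff_r treesD(2)[OF T(1,2)] by (simp add: d_eq[OF T(2,3) ne])
  have "d T u v \<le> r (lh \<alpha> u) \<longleftrightarrow> (lh \<alpha> u, split u v) \<in> \<alpha>"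
    using s(1) le_iff_r treesD(2)[OF T(1,2)] by (simp add: d_eq[OF T(2,3) ne])
  also have "\<dots> \<longleftrightarrow> u \<subseteq>\<^sub>m v"
    using s(2,3) antisym_\<alpha> refl_\<alpha>[OF s(1)] by metis
  finally show "d T u v \<le> r (lh \<alpha> u) \<longleftrightarrow> u \<subseteq>\<^sub>m v" .
qed

lemma ultrametric_space_tree:
  assumes T: "T \<in> trees \<alpha> \<kappa>"
  shows "ultrametric_space T (d T)"
proof -
  interpret Metric_space T "d T" by (rule Metric_space_tree_dist[OF wo pos dec T])
  show ?thesis by unfold_locales (rule tree_dist_ultrametric[OF wo pos dec T])
qed

section \<open>From the metric to the tree order\<close>

text \<open>At a nonleaf the lower bound \<open>r (lh \<alpha> u)\<close> is attained, so the
  nearest points are those attaining it, which are the proper extensions. The nonleaf condition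
  excludes leaves, whose nearest points do not extend them.\<close>

lemma strict_extension_iff_nearest:
  assumes T: "T \<in> trees \<alpha> \<kappa>" and uv: "u \<in> T" "v \<in> T"
  shows "u \<subseteq>\<^sub>m v \<and> u \<noteq> v \<longleftrightarrow> u \<in> nonleaves T \<and> nearest T (d T) u v"
proof
  assume l: "u \<subseteq>\<^sub>m v \<and> u \<noteq> v"
  have "d T u v \<le> d T u w" if "w \<in> T" "w \<noteq> u" for w
    using d_ge(1)[OF T uv(1) that(1)] d_ge(2)[OF T uv] l that by force
  then show "u \<in> nonleaves T \<and> nearest T (d T) u v"
    using l uv by (auto simp: nearest_def)
next
  assume n: "u \<in> nonleaves T \<and> nearest T (d T) u v"
  then obtain w where w: "w \<in> T" "u \<subseteq>\<^sub>m w" "u \<noteq> w" by blast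
  then have "d T u v \<le> d T u w" using n by (auto simp: nearest_def)
  also have "\<dots> \<le> r (lh \<alpha> u)" using d_ge(2)[OF T uv(1) w(1)] w by blast
  finally show "u \<subseteq>\<^sub>m v \<and> u \<noteq> v" using d_ge(2)[OF T uv] n by (auto simp: nearest_def)
qed

text \<open>A leaf with a nearest point is an immediate successor of a nonleaf, and all such leaves are
  metrically indistinguishable from that nonleaf.\<close>

lemma twin_transversal_nonleaves:
  assumes T: "T \<in> trees \<alpha> \<kappa>"
  shows "twin_transversal T (d T) (nonleaves T)"
  unfolding twin_transversal_def
proof (intro conjI ballI impI)
  interpret ultrametric_space T "d T" by (rule ultrametric_space_tree[OF T])
  note ext = strict_extension_iff_nearest[OF T]
  show "\<exists>v. nearest T (d T) p v" if "p \<in> nonleaves T" for p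
    using that ext by blast
  \<comment> \<open>Distinct nonleaf twins would properly extend each other.\<close>
  show "p = q" if "p \<in> nonleaves T" "q \<in> nonleaves T" "twin T (d T) p q" for p q
    using that ext[of p q] ext[of q p] map_le_antisym[of p q] by (auto simp: twin_def)
  fix u assume u: "u \<in> T" and "\<exists>v. nearest T (d T) u v"
  then obtain v where v: "nearest T (d T) u v" by blast
  show "\<exists>p\<in>nonleaves T. twin T (d T) u p"
  proof (cases "u \<in> nonleaves T")
    case True
    then show ?thesis by (auto simp: twin_def)
  next
    case False
    have vT: "v \<in> T" "u \<noteq> v" using v by (auto simp: nearest_def)
    note s = split_facts[OF T u vT]
    \<comment> \<open>\<open>w\<close> is the meet of the leaf \<open>u\<close> with its nearest
      point \<open>v\<close>. It is a proper initial segment of \<open>u\<close>, hence a nonleaf,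
      and it is no farther from \<open>u\<close> than \<open>v\<close> is.\<close>
    define w where "w = u |` underS \<alpha> (split u v)"
    have w: "w \<in> T" "lh \<alpha> w = split u v" "w \<subseteq>\<^sub>m u"
      using restrict_in_tree[OF T u s(2)] by (auto simp: w_def)
    have "w \<subseteq>\<^sub>m v" using s(4) by (simp add: w_def)
    then have wu: "w \<noteq> u" using False u vT by blast
    then have wn: "w \<in> nonleaves T" "nearest T (d T) w u"
      using ext[OF w(1) u] w(3) by auto
    have "d T u w = d T w u" by (rule commute)
    also have "\<dots> \<le> r (split u v)" using d_ge(2)[OF T w(1) u wu] w by simp
    also have "\<dots> = d T u v" using d_eq u vT by simp
    finally have "nearest T (d T) u w"
      using v w(1) wu unfolding nearest_def by (meson order_trans)
    then show ?thesis using wn by (auto simp: twin_def)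
  qed
qed blast

text \<open>The corrected isometry \<open>g\<close> preserves both nonleaves and nearest points, and
  together these determine proper extension.\<close>

lemma isomorphic_if_isometric:
  assumes T: "T \<in> trees \<alpha> \<kappa>" and S: "S \<in> trees \<alpha> \<kappa>"
    and bij: "bij_betw f T S"
    and fd: "\<forall>x\<in>T. \<forall>y\<in>T. d S (f x) (f y) = d T x y"
  shows "tree_isomorphic T S"
proof -
  interpret ultrametric_space T "d T" by (rule ultrametric_space_tree[OF T])
  obtain g where g: "bij_betw g T S"
    and gd: "\<forall>x\<in>T. \<forall>y\<in>T. d S (g x) (g y) = d T x y"
    and gn: "\<And>x. x \<in> T \<Longrightarrow> g x \<in> nonleaves S \<longleftrightarrow> x \<in> nonleaves T"
    using isometry_respecting_transversals[OF bij fd twin_transversal_nonleaves[OF T]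
        twin_transversal_nonleaves[OF S]] by blast
  have "u \<subseteq>\<^sub>m v \<longleftrightarrow> g u \<subseteq>\<^sub>m g v" if uv: "u \<in> T" "v \<in> T" for u v
  proof (cases "u = v")
    case False
    have gS: "g u \<in> S" "g v \<in> S" using g uv by (auto dest: bij_betw_apply)
    have "g u \<noteq> g v" using False g uv by (auto simp: bij_betw_def inj_on_def)
    then have "g u \<subseteq>\<^sub>m g v \<longleftrightarrow> g u \<in> nonleaves S \<and> nearest S (d S) (g u) (g v)"
      using strict_extension_iff_nearest[OF S gS] by blast
    also have "\<dots> \<longleftrightarrow> u \<in> nonleaves T \<and> nearest T (d T) u v"
      using gn[OF uv(1)] nearest_isometry[of g T S "d S" "d T", OF g gd uv] by blast
    also have "\<dots> \<longleftrightarrow> u \<subseteq>\<^sub>m v"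
      using strict_extension_iff_nearest[OF T uv] False by blast
    finally show ?thesis by blast
  qed simp
  then show ?thesis unfolding tree_isomorphic_def using g by blast
qed

section \<open>From tree isomorphisms to isometries\<close>

text \<open>The length of a node is the order type of the chain of its proper initial segments,
  which all lie in the tree. The proof is a well-founded induction on the level
  \<open>\<beta>\<close> of \<open>u\<close>, excluding a lower and a higher level of
  \<open>\<phi> u\<close> in turn.\<close>

lemma lh_isomorphism:
  assumes T: "T \<in> trees \<alpha> \<kappa>" and S: "S \<in> trees \<alpha> \<kappa>"
    and bij: "bij_betw \<phi> T S"
    and iso: "\<forall>u\<in>T. \<forall>v\<in>T. u \<subseteq>\<^sub>m v \<longleftrightarrow> \<phi> u \<subseteq>\<^sub>m \<phi> v"
    and u: "u \<in> T"
  shows "lh \<alpha> (\<phi> u) = lh \<alpha> u"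
proof -
  have wf: "wf (\<alpha> - Id)" using wo by (simp add: order_on_defs)
  have \<phi>S: "\<phi> v \<in> S" if "v \<in> T" for v using bij that by (rule bij_betw_apply)
  have inj: "v = w" if "v \<in> T" "w \<in> T" "\<phi> v = \<phi> w" for v w
    using bij that by (auto simp: bij_betw_def inj_on_def)
  have "\<forall>u\<in>T. lh \<alpha> u = \<beta> \<longrightarrow> lh \<alpha> (\<phi> u) = \<beta>" for \<beta>
  proof (induction \<beta> rule: wf_induct_rule[OF wf])
    case (1 \<beta>)
    show ?case
    proof (intro ballI impI)
      fix u assume u: "u \<in> T" "lh \<alpha> u = \<beta>"
      note uF = treesD(2)[OF T u(1)] and fF = treesD(2)[OF S \<phi>S[OF u(1)]]
      have "lh \<alpha> (\<phi> u) \<notin> underS \<alpha> \<beta>"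
      proof
        assume less: "lh \<alpha> (\<phi> u) \<in> underS \<alpha> \<beta>"
        \<comment> \<open>By induction \<open>\<phi> v\<close> has the level of
          \<open>\<phi> u\<close>; being an initial segment of \<open>\<phi> u\<close>, it equals
          it, against injectivity.\<close>
        define v where "v = u |` underS \<alpha> (lh \<alpha> (\<phi> u))"
        have v: "v \<in> T" "lh \<alpha> v = lh \<alpha> (\<phi> u)" "v \<subseteq>\<^sub>m u"
          using restrict_in_tree[OF T u(1), of "lh \<alpha> (\<phi> u)"] less u(2)
          by (auto simp: v_def underS_def)
        have "lh \<alpha> (\<phi> v) = lh \<alpha> (\<phi> u)" using 1 less v by (auto simp: underS_def)
        then have "\<phi> v = \<phi> u"
          using map_le_lh(2)[OF S \<phi>S[OF v(1)] \<phi>S[OF u(1)]] iso v u by blast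
        then have "v = u" using inj v u by blast
        then show False using v u less by (auto simp: underS_def)
      qed
      moreover have "\<beta> \<notin> underS \<alpha> (lh \<alpha> (\<phi> u))"
      proof
        assume less: "\<beta> \<in> underS \<alpha> (lh \<alpha> (\<phi> u))"
        \<comment> \<open>The preimage of \<open>w\<close> is a proper initial segment of
          \<open>u\<close>, so it lies below level \<open>\<beta>\<close>; by induction
          \<open>w\<close> has that lower level, although its length is
          \<open>\<beta>\<close>.\<close>
        define w where "w = \<phi> u |` underS \<alpha> \<beta>"
        have w: "w \<in> S" "lh \<alpha> w = \<beta>" "w \<subseteq>\<^sub>m \<phi> u"
          using restrict_in_tree[OF S \<phi>S[OF u(1)], of \<beta>] less by (auto simp: w_def underS_def)
        then obtain v where v: "v \<in> T" "w = \<phi> v" using bij by (auto simp: bij_betw_def)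
        then have vu: "v \<subseteq>\<^sub>m u" using iso u w by blast
        have "w \<noteq> \<phi> u" using w less by (auto simp: underS_def)
        then have "v \<noteq> u" using v by blast
        then have less: "(lh \<alpha> v, \<beta>) \<in> \<alpha> - Id"
          using map_le_lh[OF T v(1) u(1) vu] u(2) by auto
        then have "lh \<alpha> (\<phi> v) = lh \<alpha> v" using 1 v(1) by blast
        then show False using less v(2) w(2) by simp
      qed
      ultimately show "lh \<alpha> (\<phi> u) = \<beta>"
        using total_\<alpha>[OF uF fF] u(2) unfolding underS_def by auto
    qed
  qed
  then show ?thesis using u by blast
qed

text \<open>The image of the meet of \<open>u\<close> and \<open>v\<close> is a common initial
  segment of \<open>\<phi> u\<close> and \<open>\<phi> v\<close> of the same length, so the images
  branch no earlier. The inverse isomorphism supplies the converse inequality.\<close>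

lemma split_le_isomorphism:
  assumes T: "T \<in> trees \<alpha> \<kappa>" and S: "S \<in> trees \<alpha> \<kappa>"
    and bij: "bij_betw \<phi> T S"
    and iso: "\<forall>u\<in>T. \<forall>v\<in>T. u \<subseteq>\<^sub>m v \<longleftrightarrow> \<phi> u \<subseteq>\<^sub>m \<phi> v"
    and uv: "u \<in> T" "v \<in> T" "u \<noteq> v"
  shows "(split u v, split (\<phi> u) (\<phi> v)) \<in> \<alpha>"
proof -
  note s = split_facts[OF T uv]
  define w where "w = u |` underS \<alpha> (split u v)"
  have w: "w \<in> T" "lh \<alpha> w = split u v" "w \<subseteq>\<^sub>m u" "w \<subseteq>\<^sub>m v"
    using restrict_in_tree[OF T uv(1) s(2)] s(4) by (auto simp: w_def)
  have S': "\<phi> w \<in> S" "\<phi> u \<in> S" "\<phi> v \<in> S" "\<phi> u \<noteq> \<phi> v"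
    using bij uv w by (auto simp: bij_betw_def inj_on_def)
  have "(lh \<alpha> (\<phi> w), split (\<phi> u) (\<phi> v)) \<in> \<alpha>"
    using split_facts(5)[OF S S'(2-4) S'(1)] iso uv w by blast
  then show ?thesis using lh_isomorphism[OF T S bij iso w(1)] w(2) by simp
qed

lemma isometric_if_isomorphic:
  assumes T: "T \<in> trees \<alpha> \<kappa>" and S: "S \<in> trees \<alpha> \<kappa>"
    and bij: "bij_betw \<phi> T S"
    and iso: "\<forall>u\<in>T. \<forall>v\<in>T. u \<subseteq>\<^sub>m v \<longleftrightarrow> \<phi> u \<subseteq>\<^sub>m \<phi> v"
    and uv: "u \<in> T" "v \<in> T"
  shows "d S (\<phi> u) (\<phi> v) = d T u v"
proof (cases "u = v")
  case True
  then show ?thesis by (simp add: tree_dist_def)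
next
  case False
  let ?\<psi> = "inv_into T \<phi>"
  have inv: "bij_betw ?\<psi> S T" using bij by (rule bij_betw_inv_into)
  have inv_iso: "\<forall>x\<in>S. \<forall>y\<in>S. x \<subseteq>\<^sub>m y \<longleftrightarrow> ?\<psi> x \<subseteq>\<^sub>m ?\<psi> y"
    using iso bij by (simp add: bij_betw_inv_into_right bij_betw_apply[OF inv])
  have S': "\<phi> u \<in> S" "\<phi> v \<in> S" "\<phi> u \<noteq> \<phi> v"
    using bij uv False by (auto simp: bij_betw_def inj_on_def)
  have "(split (\<phi> u) (\<phi> v), split u v) \<in> \<alpha>"
    using split_le_isomorphism[OF S T inv inv_iso S'] bij uv by (simp add: bij_betw_inv_into_left)
  then have "split (\<phi> u) (\<phi> v) = split u v"
    using split_le_isomorphism[OF T S bij iso uv False] antisym_\<alpha> by blast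
  then show ?thesis using d_eq uv S' False by simp
qed

section \<open>Passing between trees and their completions\<close>

lemma tree_metric_simps:
  assumes "T \<in> trees \<alpha> \<kappa>"
  shows "mspace (tree_metric \<alpha> \<kappa> r T) = T" "mdist (tree_metric \<alpha> \<kappa> r T) = d T"
proof -
  interpret Metric_space T "d T" by (rule Metric_space_tree_dist[OF wo pos dec assms])
  show "mspace (tree_metric \<alpha> \<kappa> r T) = T" "mdist (tree_metric \<alpha> \<kappa> r T) = d T"
    by (simp_all add: tree_metric_def)
qed

text \<open>The radius is \<open>r (lh \<alpha> x)\<close>, by \<open>d_ge\<close>.\<close>

lemma tree_metric_discrete:
  assumes T: "T \<in> trees \<alpha> \<kappa>" and x: "x \<in> mspace (tree_metric \<alpha> \<kappa> r T)"
  shows "\<exists>e>0. \<forall>y\<in>mspace (tree_metric \<alpha> \<kappa> r T). mdist (tree_metric \<alpha> \<kappa> r T) x y < e \<longrightarrow> y = x"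
  using d_ge(1)[OF T] pos[of "lh \<alpha> x"] treesD(2)[OF T] x
  unfolding tree_metric_simps[OF T] by (metis not_less)

lemma isomorphic_iff_isometric_tree_metrics:
  assumes "T \<in> trees \<alpha> \<kappa>" "S \<in> trees \<alpha> \<kappa>"
  shows "tree_isomorphic T S \<longleftrightarrow>
    isometric_spaces (tree_metric \<alpha> \<kappa> r T) (tree_metric \<alpha> \<kappa> r S)"
  unfolding isometric_spaces_def tree_metric_simps[OF assms(1)] tree_metric_simps[OF assms(2)]
proof
  assume "tree_isomorphic T S"
  then obtain \<phi> where "bij_betw \<phi> T S"
    and "\<forall>u\<in>T. \<forall>v\<in>T. u \<subseteq>\<^sub>m v \<longleftrightarrow> \<phi> u \<subseteq>\<^sub>m \<phi> v"
    unfolding tree_isomorphic_def by blast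
  then show "\<exists>f. bij_betw f T S \<and> (\<forall>x\<in>T. \<forall>y\<in>T. d S (f x) (f y) = d T x y)"
    using isometric_if_isomorphic[OF assms] by blast
next
  assume "\<exists>f. bij_betw f T S \<and> (\<forall>x\<in>T. \<forall>y\<in>T. d S (f x) (f y) = d T x y)"
  then show "tree_isomorphic T S" using isomorphic_if_isometric[OF assms] by blast
qed

end

theorem theorem3p5:
  fixes \<alpha> :: "'a rel" and \<kappa> :: "'k rel" and r :: "'a \<Rightarrow> real"
    and T S :: "('a \<rightharpoonup> 'k) set"
  assumes "Well_order \<alpha>" and "countable (Field \<alpha>)"
    and "Card_order \<kappa>" and "infinite (Field \<kappa>)"
    and "\<And>\<beta>. \<beta> \<in> Field \<alpha> \<Longrightarrow> 0 < r \<beta>"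
    and "\<And>\<beta> \<gamma>. (\<beta>, \<gamma>) \<in> \<alpha> \<Longrightarrow> \<beta> \<noteq> \<gamma> \<Longrightarrow> r \<gamma> < r \<beta>"
    and "T \<in> trees \<alpha> \<kappa>" and "S \<in> trees \<alpha> \<kappa>"
  shows "tree_isomorphic T S \<longleftrightarrow>
         isometric_spaces (tree_space \<alpha> \<kappa> r T) (tree_space \<alpha> \<kappa> r S)"
proof -
  interpret tree_metrics \<alpha> \<kappa> r by unfold_locales (rule assms; assumption)+
  let ?m = "tree_metric \<alpha> \<kappa> r"
  note compl = is_completion_mcompletion[of "?m T"] is_completion_mcompletion[of "?m S"]
  \<comment> \<open>One direction extends an isometry to the completions; the other restricts it to
    isolated points, by discreteness of the tree metrics.\<close>
  have "isometric_spaces (?m T) (?m S) \<longleftrightarrow>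
      isometric_spaces (tree_space \<alpha> \<kappa> r T) (tree_space \<alpha> \<kappa> r S)"
    unfolding tree_space_def
    using completions_isometric[OF compl] isometric_if_completions_isometric[OF compl]
      tree_metric_discrete[OF assms(7)] tree_metric_discrete[OF assms(8)] by blast
  then show ?thesis using isomorphic_iff_isometric_tree_metrics[OF assms(7,8)] by simp
qed

end
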